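(* Let $A,B\in\mathcal{K}^d_{kc}$ and let $\mathcal{M}$ be the (non-empty) set of all $X\in\mathcal{K}^d_{kc}$ with $d_H(A,B\oplus X)=\inf_{Y\in\mathcal{K}^d_{kc}} d_H(A,B\oplus Y)$. Let $R: \mathcal{K}^d_{kc} \to [0, \infty)$ be strictly convex and lower semicontinuous and, for $\gamma>0$, let $$X^*_{\gamma} = \arg \min_{X \in \mathcal{K}^d_{kc}} \left[d_H(A, B \oplus X) + \gamma R(X)\right].$$ Then, as $\gamma \to 0^+$, $X^*_{\gamma}$ converges in the Hausdorff metric to one of the solutions in $\mathcal{M}$; i.e. there is $X_0\in\mathcal{M}$ with $d_H(X^*_\gamma,X_0)\to 0$ as $\gamma\to0^+$.
   Context: $\mathcal{K}^d_{kc}$ is the set of all nonempty compact convex subsets of Euclidean space $\mathbb{R}^d$ (with norm $\|\cdot\|$). Minkowski sum: $A\oplus B=\{a+b: a\in A, b\in B\}$; $\lambda A=\{\lambda a: a\in A\}$. Hausdorff distance: $d_H(A,B)=\max\{\sup_{a\in A}\inf_{b\in B}\|a-b\|,\ \sup_{b\in B}\inf_{a\in A}\|a-b\|\}$. $R$ is strictly convex if $R(\lambda X_1\oplus(1-\lambda)X_2)<\lambda R(X_1)+(1-\lambda)R(X_2)$ for all $X_1\neq X_2$ in $\mathcal{K}^d_{kc}$ and $\lambda\in(0,1)$. Lower semicontinuity is with respect to $d_H$. $X^*_\gamma$ denotes the unique minimizer of the perturbed problem. *)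

theory Defs
  imports "HOL-Analysis.Analysis" "HOL-Library.Set_Algebras"
begin

text \<open>
  The Minkowski sum of two sets is \<open>A + B\<close> from the theory of set algebras; the dilation
  of \<open>A\<close> by \<open>c\<close> is the image \<open>(*\<^sub>R) c ` A\<close>.
\<close>

definition kc_sets :: "'a::euclidean_space set set"
  where "kc_sets = {X. X \<noteq> {} \<and> compact X \<and> convex X}"

text \<open>
  The suprema and infima below are those of the reals, hence meaningful only for nonempty
  bounded sets; all uses are for members of \<open>kc_sets\<close>.
\<close>

definition hausdorff_dist :: "'a::euclidean_space set \<Rightarrow> 'a set \<Rightarrow> real"
  where "hausdorff_dist A B =
    max (SUP a\<in>A. INF b\<in>B. norm (a - b)) (SUP b\<in>B. INF a\<in>A. norm (a - b))"

definition strictly_convex_kc :: "('a::euclidean_space set \<Rightarrow> real) \<Rightarrow> bool"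
  where "strictly_convex_kc R \<longleftrightarrow>
    (\<forall>X\<in>kc_sets. \<forall>Y\<in>kc_sets. \<forall>t::real. X \<noteq> Y \<longrightarrow> 0 < t \<longrightarrow> t < 1 \<longrightarrow>
      R ((*\<^sub>R) t ` X + (*\<^sub>R) (1 - t) ` Y) < t * R X + (1 - t) * R Y)"

definition lower_semicontinuous_kc :: "('a::euclidean_space set \<Rightarrow> real) \<Rightarrow> bool"
  where "lower_semicontinuous_kc R \<longleftrightarrow>
    (\<forall>X\<in>kc_sets. \<forall>e>0. \<exists>d>0. \<forall>Y\<in>kc_sets. hausdorff_dist Y X < d \<longrightarrow> R X - e < R Y)"

definition minkowski_solutions :: "'a::euclidean_space set \<Rightarrow> 'a set \<Rightarrow> 'a set set"
  where "minkowski_solutions A B =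
    {X \<in> kc_sets. hausdorff_dist A (B + X) = (INF Y\<in>kc_sets. hausdorff_dist A (B + Y))}"

text \<open>
  \<open>arg_min_on\<close> selects some minimizer over \<open>kc_sets\<close>, and is unspecified if there is none.
  For \<open>g > 0\<close> and \<open>R\<close> nonnegative, strictly convex and lower semicontinuous the minimizer
  exists and is unique; this is not built into the definition.
\<close>

definition regularized_solution ::
  "'a::euclidean_space set \<Rightarrow> 'a set \<Rightarrow> ('a set \<Rightarrow> real) \<Rightarrow> real \<Rightarrow> 'a set"
  where "regularized_solution A B R g =
    arg_min_on (\<lambda>X. hausdorff_dist A (B + X) + g * R X) kc_sets"

end

theory Submission
  imports Defs "HOL-Complex_Analysis.Great_Picard"
begin

text \<open>
  Write \<open>f X\<close> for the Hausdorff distance from \<open>A\<close> to \<open>B + X\<close>. The limit \<open>X0\<close> is the element of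
  the solution set that minimizes \<open>R\<close>: the penalty vanishes in the limit, but among the minimizers
  of \<open>f\<close> it selects the one that is cheapest for \<open>R\<close>.

  The function \<open>f\<close> is 1-Lipschitz, convex, and coercive in the sense that a bound on \<open>f X\<close> confines
  \<open>X\<close> to a fixed ball (lemmas \<open>hausdorff_dist_sum_Lipschitz\<close>, \<open>hausdorff_dist_sum_convex\<close> and
  \<open>hausdorff_dist_sum_coercive\<close>). By Blaschke's selection theorem (\<open>Blaschke_selection\<close>), a sequence
  of compact convex sets along which \<open>f\<close> is bounded therefore has a convergent subsequence. Hence
  \<open>f + g R\<close>, being lower semicontinuous, has a minimizer for every \<open>g \<ge> 0\<close>; the case \<open>g = 0\<close> says that the
  solution set is nonempty. The same compactness makes \<open>R\<close> attain its minimum on the solution set,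
  and because that set is convex and \<open>R\<close> is strictly convex, it does so at exactly one \<open>X0\<close>.

  For the convergence, compare the minimizer \<open>X\<close> of \<open>f + g R\<close> with \<open>X0\<close>: since
  \<open>f X0 \<le> f X\<close>, one gets both \<open>R X \<le> R X0\<close> and \<open>f X \<le> f X0 + g R X0\<close>. If \<open>g \<rightarrow> 0\<close> along a sequence
  on which \<open>X\<close> stays away from \<open>X0\<close>, a subsequence converges to some \<open>Y\<close>. By lower semicontinuity
  \<open>Y\<close> minimizes \<open>f\<close> and satisfies \<open>R Y \<le> R X0\<close>, so \<open>Y = X0\<close> by uniqueness, a contradiction.
\<close>

section \<open>Compact convex sets and the Hausdorff distance\<close>

lemma kc_sets_plus:
  assumes "X \<in> kc_sets" "Y \<in> kc_sets"
  shows "X + Y \<in> kc_sets"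
proof -
  have "X + Y = {x + y |x y. x \<in> X \<and> y \<in> Y}"
    by (auto simp: set_plus_def)
  then have "compact (X + Y)"
    using assms compact_sums[of X Y] by (simp add: kc_sets_def)
  moreover have "X + Y \<noteq> {}"
    using assms by (auto simp: kc_sets_def set_plus_def)
  ultimately show ?thesis
    using assms by (simp add: kc_sets_def convex_set_plus)
qed

lemma kc_sets_scaleR:
  "X \<in> kc_sets \<Longrightarrow> (*\<^sub>R) c ` X \<in> kc_sets"
  by (simp add: kc_sets_def convex_scaling compact_scaling)

lemma kc_sets_convex_combination:
  assumes "X \<in> kc_sets" "Y \<in> kc_sets"
  shows "(*\<^sub>R) t ` X + (*\<^sub>R) (1 - t) ` Y \<in> kc_sets"
  using assms by (simp add: kc_sets_plus kc_sets_scaleR)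

lemma kc_sets_bounded_norm:
  assumes "X \<in> kc_sets"
  shows "\<exists>a. \<forall>x\<in>X. norm x \<le> a"
  using assms compact_imp_bounded[of X] by (simp add: kc_sets_def bounded_iff)

lemma singleton_kc: "{x} \<in> kc_sets"
  by (simp add: kc_sets_def)

text \<open>
  Compactness turns the suprema and infima in the definition into maxima and minima. All later
  estimates of Hausdorff distances go through this lemma.
\<close>

lemma hausdorff_dist_le_iff_infdist:
  assumes "X \<in> kc_sets" "Y \<in> kc_sets"
  shows "hausdorff_dist X Y \<le> e \<longleftrightarrow> (\<forall>x\<in>X. infdist x Y \<le> e) \<and> (\<forall>y\<in>Y. infdist y X \<le> e)"
proof -
  have ne: "X \<noteq> {}" "Y \<noteq> {}" and c: "compact X" "compact Y"
    using assms by (auto simp: kc_sets_def)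
  have inf: "(INF y\<in>Y. norm (x - y)) = infdist x Y" "(INF y\<in>X. norm (y - x)) = infdist x X" for x
    using ne by (simp_all add: infdist_notempty dist_norm norm_minus_commute)
  have bdd: "bdd_above ((\<lambda>x. infdist x T) ` S)" if "compact S" for S T :: "'a set"
    by (intro bounded_imp_bdd_above compact_imp_bounded compact_continuous_image that
        continuous_intros)
  show ?thesis
    unfolding hausdorff_dist_def inf
    using ne bdd[OF c(1)] bdd[OF c(2)] by (simp add: cSUP_le_iff)
qed

lemma infdist_le_iff_near:
  assumes "Y \<in> kc_sets"
  shows "infdist x Y \<le> e \<longleftrightarrow> (\<exists>y\<in>Y. norm (x - y) \<le> e)"
proof
  assume e: "infdist x Y \<le> e"
  obtain y where "y \<in> Y" "infdist x Y = dist x y"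
    using infdist_attains_inf[of Y x] assms by (auto simp: kc_sets_def compact_imp_closed)
  with e show "\<exists>y\<in>Y. norm (x - y) \<le> e"
    by (auto simp: dist_norm)
qed (auto intro: infdist_le2 simp: dist_norm)

lemma hausdorff_dist_le_iff:
  assumes "X \<in> kc_sets" "Y \<in> kc_sets"
  shows "hausdorff_dist X Y \<le> e \<longleftrightarrow>
    (\<forall>x\<in>X. \<exists>y\<in>Y. norm (x - y) \<le> e) \<and> (\<forall>y\<in>Y. \<exists>x\<in>X. norm (x - y) \<le> e)"
  by (simp add: hausdorff_dist_le_iff_infdist infdist_le_iff_near assms norm_minus_commute)

lemma hausdorff_dist_nearest:
  assumes "X \<in> kc_sets" "Y \<in> kc_sets"
  shows "x \<in> X \<Longrightarrow> \<exists>y\<in>Y. norm (x - y) \<le> hausdorff_dist X Y"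
    and "y \<in> Y \<Longrightarrow> \<exists>x\<in>X. norm (x - y) \<le> hausdorff_dist X Y"
  using hausdorff_dist_le_iff[OF assms, of "hausdorff_dist X Y"] by auto

lemma hausdorff_dist_nonneg:
  assumes "X \<in> kc_sets" "Y \<in> kc_sets"
  shows "0 \<le> hausdorff_dist X Y"
proof -
  obtain x where "x \<in> X"
    using assms by (auto simp: kc_sets_def)
  then obtain y where "norm (x - y) \<le> hausdorff_dist X Y"
    using hausdorff_dist_nearest(1)[OF assms] by blast
  then show ?thesis
    using norm_ge_zero order_trans by blast
qed

lemma hausdorff_dist_triangle:
  assumes "X \<in> kc_sets" "Y \<in> kc_sets" "Z \<in> kc_sets"
  shows "hausdorff_dist X Z \<le> hausdorff_dist X Y + hausdorff_dist Y Z"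
proof -
  have "\<exists>z\<in>Z. norm (x - z) \<le> hausdorff_dist X Y + hausdorff_dist Y Z" if "x \<in> X" for x
    using hausdorff_dist_nearest(1)[OF assms(1,2) that] hausdorff_dist_nearest(1)[OF assms(2,3)]
    by (meson norm_diff_triangle_le)
  moreover have "\<exists>x\<in>X. norm (x - z) \<le> hausdorff_dist X Y + hausdorff_dist Y Z" if "z \<in> Z" for z
    using hausdorff_dist_nearest(2)[OF assms(2,3) that] hausdorff_dist_nearest(2)[OF assms(1,2)]
    by (meson norm_diff_triangle_le)
  ultimately show ?thesis
    using assms by (simp add: hausdorff_dist_le_iff)
qed

section \<open>Blaschke's selection theorem\<close>

lemma infdist_convex_combination:
  assumes X: "X \<in> kc_sets" and t: "0 \<le> u" "0 \<le> v" "u + v = 1"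
  shows "infdist (u *\<^sub>R x + v *\<^sub>R y) X \<le> u * infdist x X + v * infdist y X"
proof -
  obtain a b where ab: "a \<in> X" "norm (x - a) \<le> infdist x X" "b \<in> X" "norm (y - b) \<le> infdist y X"
    using infdist_le_iff_near[OF X] by blast
  have "norm ((u *\<^sub>R x + v *\<^sub>R y) - (u *\<^sub>R a + v *\<^sub>R b)) = norm (u *\<^sub>R (x - a) + v *\<^sub>R (y - b))"
    by (simp add: algebra_simps)
  also have "\<dots> \<le> u * norm (x - a) + v * norm (y - b)"
    using t by (metis abs_of_nonneg norm_scaleR norm_triangle_ineq)
  also have "\<dots> \<le> u * infdist x X + v * infdist y X"
    using ab t by (intro add_mono mult_left_mono)
  finally show ?thesis
    using X t ab convexD[of X a b u v] by (auto simp: infdist_le_iff_near kc_sets_def)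
qed

text \<open>
  A set is recovered from its distance function \<open>\<lambda>x. infdist x X\<close> as the zero set, and distance
  functions are 1-Lipschitz, so Arzela-Ascoli yields a uniformly convergent subsequence on a large
  ball. The point is that the limit is again the distance function of its own zero set \<open>Y\<close>: the
  points of the sets nearest to a given \<open>x\<close> accumulate at a point of \<open>Y\<close>. Uniform closeness of the
  distance functions is closeness in the Hausdorff metric.
\<close>

theorem Blaschke_selection:
  fixes X :: "nat \<Rightarrow> 'a::euclidean_space set"
  assumes X: "\<And>n. X n \<in> kc_sets" and sub: "\<And>n. X n \<subseteq> cball 0 K"
  obtains Y r where "Y \<in> kc_sets" "strict_mono (r :: nat \<Rightarrow> nat)"
    "(\<lambda>n. hausdorff_dist (X (r n)) Y) \<longlonglongrightarrow> 0"
proof -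
  let ?S = "cball (0::'a) K"
  have ne: "X n \<noteq> {}" for n
    using X by (auto simp: kc_sets_def)
  have near: "\<exists>y\<in>X n. norm (x - y) \<le> infdist x (X n)" for n x
    using infdist_le_iff_near[OF X] by blast
  have bound: "norm (infdist x (X n)) \<le> 2 * K" if x: "x \<in> ?S" for n x
  proof -
    obtain y where y: "y \<in> X n"
      using ne by blast
    have "infdist x (X n) \<le> norm (x - y)"
      using infdist_le[OF y] by (simp add: dist_norm)
    moreover have "norm (x - y) \<le> norm x + norm y" "norm x \<le> K" "norm y \<le> K"
      using x y sub[of n] by (auto simp: norm_triangle_ineq4)
    ultimately show ?thesis
      by (simp add: infdist_nonneg)
  qed
  have equi: "\<exists>d>0. \<forall>n y. y \<in> ?S \<and> norm (x - y) < d \<longrightarrow>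
      norm (infdist x (X n) - infdist y (X n)) < e" if "0 < e" for x and e :: real
    using that by (intro exI[of _ e])
      (auto simp: dist_norm intro: le_less_trans[OF infdist_triangle_abs])
  obtain g k where g: "continuous_on ?S g" and k: "strict_mono (k :: nat \<Rightarrow> nat)"
    and unif: "\<And>e. 0 < e \<Longrightarrow> \<exists>N. \<forall>n x. n \<ge> N \<and> x \<in> ?S \<longrightarrow> norm (infdist x (X (k n)) - g x) < e"
    using Arzela_Ascoli[of ?S "\<lambda>n x. infdist x (X n)" "2 * K", OF compact_cball bound equi]
    by blast
  have lim: "(\<lambda>n. infdist x (X (k n))) \<longlonglongrightarrow> g x" if "x \<in> ?S" for x
    using unif that by (simp add: LIMSEQ_iff) blast
  define Y where "Y = {x \<in> ?S. g x = 0}"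
  have gY: "\<exists>y\<in>Y. norm (x - y) \<le> g x" if x: "x \<in> ?S" for x
  proof -
    obtain p where p: "\<And>n. p n \<in> X (k n)" "\<And>n. norm (x - p n) \<le> infdist x (X (k n))"
      using choice[of "\<lambda>n y. y \<in> X (k n) \<and> norm (x - y) \<le> infdist x (X (k n))"] near by blast
    have "\<And>n. p n \<in> ?S"
      using p(1) sub by blast
    then obtain y s where y: "y \<in> ?S" and s: "strict_mono (s :: nat \<Rightarrow> nat)"
      and py: "(p \<circ> s) \<longlonglongrightarrow> y"
      using compact_cball[of "0::'a" K] unfolding compact_def by metis
    have "(\<lambda>n. infdist y (X (k (s n)))) \<longlonglongrightarrow> g y"
      using LIMSEQ_subseq_LIMSEQ[OF lim[OF y] s] by (simp add: o_def)
    moreover have "(\<lambda>n. dist y (p (s n))) \<longlonglongrightarrow> dist y y"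
      using py by (intro tendsto_intros) (simp add: o_def)
    ultimately have "g y \<le> 0"
      using p(1) by (intro tendsto_le[of sequentially "\<lambda>n. dist y (p (s n))" 0])
        (auto intro!: always_eventually infdist_le)
    moreover have "0 \<le> g y"
      using lim[OF y] by (rule tendsto_lowerbound) (auto simp: infdist_nonneg)
    ultimately have "y \<in> Y"
      using y by (simp add: Y_def)
    have "(\<lambda>n. norm (x - p (s n))) \<longlonglongrightarrow> norm (x - y)"
      using py by (intro tendsto_intros) (simp add: o_def)
    moreover have "(\<lambda>n. infdist x (X (k (s n)))) \<longlonglongrightarrow> g x"
      using LIMSEQ_subseq_LIMSEQ[OF lim[OF x] s] by (simp add: o_def)
    ultimately have "norm (x - y) \<le> g x"
      using p(2) by (intro tendsto_le[of sequentially]) auto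
    with \<open>y \<in> Y\<close> show ?thesis by blast
  qed
  have "convex Y"
  proof (rule convexI)
    fix x y and u v :: real
    assume xy: "x \<in> Y" "y \<in> Y" and uv: "0 \<le> u" "0 \<le> v" "u + v = 1"
    let ?z = "u *\<^sub>R x + v *\<^sub>R y"
    have xyS: "x \<in> ?S" "y \<in> ?S" and z: "?z \<in> ?S"
      using xy uv convexD[OF convex_cball, of x 0 K y u v] by (auto simp: Y_def)
    have "(\<lambda>n. u * infdist x (X (k n)) + v * infdist y (X (k n))) \<longlonglongrightarrow> u * g x + v * g y"
      by (intro tendsto_intros lim xyS)
    then have "g ?z \<le> u * g x + v * g y"
      using lim[OF z] infdist_convex_combination[OF X uv]
      by (intro tendsto_le[of sequentially]) auto
    moreover have "0 \<le> g ?z"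
      using lim[OF z] by (rule tendsto_lowerbound) (auto simp: infdist_nonneg)
    ultimately show "?z \<in> Y"
      using xy z by (simp add: Y_def)
  qed
  moreover have "compact Y"
  proof -
    have "closed (?S \<inter> g -` {0})"
      using g by (intro continuous_closed_preimage) auto
    moreover have "?S \<inter> g -` {0} = ?S \<inter> Y"
      by (auto simp: Y_def)
    moreover have "?S \<inter> Y = Y"
      by (auto simp: Y_def)
    ultimately show ?thesis
      using compact_Int_closed[OF compact_cball, of Y 0 K] by simp
  qed
  moreover have "Y \<noteq> {}"
  proof -
    obtain x where "x \<in> X 0"
      using ne by blast
    then show ?thesis
      using gY[of x] sub by blast
  qed
  ultimately have Y: "Y \<in> kc_sets"
    by (simp add: kc_sets_def)
  have "(\<lambda>n. hausdorff_dist (X (k n)) Y) \<longlonglongrightarrow> 0"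
  proof (rule LIMSEQ_I)
    fix e :: real
    assume e: "0 < e"
    then obtain N where N: "\<And>n x. n \<ge> N \<Longrightarrow> x \<in> ?S \<Longrightarrow> norm (infdist x (X (k n)) - g x) < e / 2"
      using unif[of "e / 2"] by auto
    have "hausdorff_dist (X (k n)) Y \<le> e / 2" if n: "n \<ge> N" for n
      unfolding hausdorff_dist_le_iff_infdist[OF X Y]
    proof (intro conjI ballI)
      fix x assume x: "x \<in> X (k n)"
      then have "x \<in> ?S" using sub by blast
      moreover from x have "infdist x (X (k n)) = 0" by simp
      ultimately have "g x \<le> e / 2"
        using N[OF n, of x] by simp
      then show "infdist x Y \<le> e / 2"
        using gY[OF \<open>x \<in> ?S\<close>] infdist_le_iff_near[OF Y] order_trans by blast
    next
      fix y assume "y \<in> Y"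
      then show "infdist y (X (k n)) \<le> e / 2"
        using N[OF n, of y] by (simp add: Y_def)
    qed
    then have "norm (hausdorff_dist (X (k n)) Y - 0) < e" if "n \<ge> N" for n
      using e hausdorff_dist_nonneg[OF X Y, of "k n"] that by fastforce
    then show "\<exists>N. \<forall>n\<ge>N. norm (hausdorff_dist (X (k n)) Y - 0) < e"
      by blast
  qed
  with Y k show thesis
    by (rule that)
qed

section \<open>The data-fit term\<close>

lemma hausdorff_dist_sum_Lipschitz:
  assumes A: "A \<in> kc_sets" and B: "B \<in> kc_sets" and X: "X \<in> kc_sets" and Y: "Y \<in> kc_sets"
  shows "hausdorff_dist A (B + X) \<le> hausdorff_dist A (B + Y) + hausdorff_dist Y X"
proof -
  have "hausdorff_dist (B + Y) (B + X) \<le> hausdorff_dist Y X"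
    unfolding hausdorff_dist_le_iff[OF kc_sets_plus[OF B Y] kc_sets_plus[OF B X]]
  proof (intro conjI ballI)
    fix z assume "z \<in> B + Y"
    then obtain b y where z: "z = b + y" "b \<in> B" "y \<in> Y" by (rule set_plus_elim)
    moreover obtain x where "x \<in> X" "norm (y - x) \<le> hausdorff_dist Y X"
      using hausdorff_dist_nearest(1)[OF Y X \<open>y \<in> Y\<close>] by blast
    ultimately show "\<exists>w\<in>B + X. norm (z - w) \<le> hausdorff_dist Y X"
      by (intro bexI[of _ "b + x"]) auto
  next
    fix z assume "z \<in> B + X"
    then obtain b x where z: "z = b + x" "b \<in> B" "x \<in> X" by (rule set_plus_elim)
    moreover obtain y where "y \<in> Y" "norm (y - x) \<le> hausdorff_dist Y X"
      using hausdorff_dist_nearest(2)[OF Y X \<open>x \<in> X\<close>] by blast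
    ultimately show "\<exists>w\<in>B + Y. norm (w - z) \<le> hausdorff_dist Y X"
      by (intro bexI[of _ "b + y"]) auto
  qed
  then show ?thesis
    using hausdorff_dist_triangle[OF A kc_sets_plus[OF B Y] kc_sets_plus[OF B X]] by linarith
qed

lemma hausdorff_dist_sum_coercive:
  assumes "A \<in> kc_sets" "B \<in> kc_sets"
  shows "\<exists>K. \<forall>X\<in>kc_sets. hausdorff_dist A (B + X) \<le> c \<longrightarrow> X \<subseteq> cball 0 K"
proof -
  obtain a where a: "\<And>x. x \<in> A \<Longrightarrow> norm x \<le> a"
    using kc_sets_bounded_norm[OF assms(1)] by blast
  obtain b where b: "\<And>x. x \<in> B \<Longrightarrow> norm x \<le> b"
    using kc_sets_bounded_norm[OF assms(2)] by blast
  obtain b0 where b0: "b0 \<in> B"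
    using assms by (auto simp: kc_sets_def)
  have "norm x \<le> a + b + c" if X: "X \<in> kc_sets" "hausdorff_dist A (B + X) \<le> c" "x \<in> X" for X x
  proof -
    have "b0 + x \<in> B + X"
      using b0 X by blast
    then obtain p where p: "p \<in> A" "norm (p - (b0 + x)) \<le> c"
      using hausdorff_dist_nearest(2)[OF assms(1) kc_sets_plus[OF assms(2) X(1)]] X(2) order_trans
      by blast
    have "x = p - b0 - (p - (b0 + x))" by simp
    then have "norm x \<le> norm p + norm b0 + norm (p - (b0 + x))"
      by (smt (verit) norm_triangle_ineq4)
    then show ?thesis
      using a[OF p(1)] b[OF b0] p(2) by linarith
  qed
  then show ?thesis
    by (intro exI[of _ "a + b + c"]) auto
qed

text \<open>
  A point of \<open>A\<close> is approximated by the combination of its neighbours in \<open>B + X\<close> and \<open>B + Y\<close>, whose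
  \<open>B\<close>-parts recombine to one point because \<open>B\<close> is convex. Conversely, a point built from \<open>b\<close>, \<open>x\<close> and
  \<open>y\<close> is approximated by the combination of the neighbours of \<open>b + x\<close> and \<open>b + y\<close> in \<open>A\<close>, which
  remains in \<open>A\<close> because \<open>A\<close> is convex.
\<close>

lemma hausdorff_dist_sum_convex:
  assumes A: "A \<in> kc_sets" and B: "B \<in> kc_sets" and X: "X \<in> kc_sets" and Y: "Y \<in> kc_sets"
    and t: "0 \<le> t" "t \<le> 1"
  shows "hausdorff_dist A (B + ((*\<^sub>R) t ` X + (*\<^sub>R) (1 - t) ` Y))
    \<le> t * hausdorff_dist A (B + X) + (1 - t) * hausdorff_dist A (B + Y)" (is "_ \<le> ?d")
proof -
  let ?Z = "(*\<^sub>R) t ` X + (*\<^sub>R) (1 - t) ` Y"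
  note BX = kc_sets_plus[OF B X] and BY = kc_sets_plus[OF B Y]
  have Z: "B + ?Z \<in> kc_sets"
    by (intro kc_sets_plus kc_sets_scaleR B X Y)
  have cA: "t *\<^sub>R a + (1 - t) *\<^sub>R a' \<in> A" if "a \<in> A" "a' \<in> A" for a a'
    using A that t convexD[of A a a' t "1 - t"] by (simp add: kc_sets_def)
  have cB: "t *\<^sub>R b + (1 - t) *\<^sub>R b' \<in> B" if "b \<in> B" "b' \<in> B" for b b'
    using B that t convexD[of B b b' t "1 - t"] by (simp add: kc_sets_def)
  have est: "norm (t *\<^sub>R p + (1 - t) *\<^sub>R q) \<le> ?d"
    if "norm p \<le> hausdorff_dist A (B + X)" "norm q \<le> hausdorff_dist A (B + Y)" for p q
  proof -
    have "norm (t *\<^sub>R p + (1 - t) *\<^sub>R q) \<le> t * norm p + (1 - t) * norm q"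
      using t norm_triangle_ineq[of "t *\<^sub>R p" "(1 - t) *\<^sub>R q"] by simp
    also have "\<dots> \<le> ?d"
      using t that by (intro add_mono mult_left_mono) auto
    finally show ?thesis .
  qed
  show ?thesis
    unfolding hausdorff_dist_le_iff[OF A Z]
  proof (intro conjI ballI)
    fix a assume a: "a \<in> A"
    obtain p where p: "p \<in> B + X" "norm (a - p) \<le> hausdorff_dist A (B + X)"
      using hausdorff_dist_nearest(1)[OF A BX a] by blast
    obtain b x where bx: "p = b + x" "b \<in> B" "x \<in> X"
      using p(1) by (rule set_plus_elim)
    obtain q where q: "q \<in> B + Y" "norm (a - q) \<le> hausdorff_dist A (B + Y)"
      using hausdorff_dist_nearest(1)[OF A BY a] by blast
    obtain b' y where b'y: "q = b' + y" "b' \<in> B" "y \<in> Y"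
      using q(1) by (rule set_plus_elim)
    let ?z = "(t *\<^sub>R b + (1 - t) *\<^sub>R b') + (t *\<^sub>R x + (1 - t) *\<^sub>R y)"
    have "?z \<in> B + ?Z"
      using cB bx b'y by (intro set_plus_intro imageI) auto
    moreover have "a - ?z = t *\<^sub>R (a - p) + (1 - t) *\<^sub>R (a - q)"
      by (simp add: bx b'y algebra_simps)
    ultimately show "\<exists>z\<in>B + ?Z. norm (a - z) \<le> ?d"
      using est[OF p(2) q(2)] by (intro bexI[of _ ?z]) simp_all
  next
    fix z assume "z \<in> B + ?Z"
    then obtain b x y where z: "z = b + (t *\<^sub>R x + (1 - t) *\<^sub>R y)" and bxy: "b \<in> B" "x \<in> X" "y \<in> Y"
      by (auto simp: set_plus_def)
    obtain a where a: "a \<in> A" "norm (a - (b + x)) \<le> hausdorff_dist A (B + X)"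
      using hausdorff_dist_nearest(2)[OF A BX, of "b + x"] bxy by blast
    obtain a' where a': "a' \<in> A" "norm (a' - (b + y)) \<le> hausdorff_dist A (B + Y)"
      using hausdorff_dist_nearest(2)[OF A BY, of "b + y"] bxy by blast
    have "(t *\<^sub>R a + (1 - t) *\<^sub>R a') - z = t *\<^sub>R (a - (b + x)) + (1 - t) *\<^sub>R (a' - (b + y))"
      by (simp add: z algebra_simps)
    then show "\<exists>a\<in>A. norm (a - z) \<le> ?d"
      using est[OF a(2) a'(2)] cA[OF a(1) a'(1)] by (intro bexI[of _ "t *\<^sub>R a + (1 - t) *\<^sub>R a'"]) simp_all
  qed
qed

lemma hausdorff_dist_sum_bounded_imp_convergent_subseq:
  assumes "A \<in> kc_sets" "B \<in> kc_sets"
    and X: "\<And>n. X n \<in> kc_sets" and "\<And>n. hausdorff_dist A (B + X n) \<le> c"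
  shows "\<exists>Y\<in>kc_sets. \<exists>r::nat \<Rightarrow> nat. strict_mono r \<and> (\<lambda>n. hausdorff_dist (X (r n)) Y) \<longlonglongrightarrow> 0"
proof -
  obtain K where "\<And>n. X n \<subseteq> cball 0 K"
    using hausdorff_dist_sum_coercive[OF assms(1,2), of c] X assms(4) by blast
  then show ?thesis
    by (rule Blaschke_selection[of X, OF X]) blast
qed

section \<open>Lower semicontinuous functionals\<close>

lemma lower_semicontinuous_kc_le_limit:
  assumes F: "lower_semicontinuous_kc F" and Y: "Y \<in> kc_sets" and X: "\<And>n. X n \<in> kc_sets"
    and lim: "(\<lambda>n. hausdorff_dist (X n) Y) \<longlonglongrightarrow> 0"
    and u: "\<And>n. F (X n) \<le> u n" "u \<longlonglongrightarrow> l"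
  shows "F Y \<le> l"
proof (rule field_le_epsilon)
  fix e :: real assume "0 < e"
  then obtain d where d: "0 < d" "\<And>Z. Z \<in> kc_sets \<Longrightarrow> hausdorff_dist Z Y < d \<Longrightarrow> F Y - e < F Z"
    using F Y unfolding lower_semicontinuous_kc_def by meson
  have "\<forall>\<^sub>F n in sequentially. hausdorff_dist (X n) Y < d"
    using lim d(1) by (rule order_tendstoD)
  then have "\<forall>\<^sub>F n in sequentially. F Y - e \<le> u n"
    by eventually_elim (use d(2) X u(1) in \<open>smt (verit)\<close>)
  then have "F Y - e \<le> l"
    by (rule tendsto_lowerbound[OF u(2)]) simp
  then show "F Y \<le> l + e" by simp
qed

text \<open>
  The direct method. The set \<open>S\<close> is a parameter because it is applied both to the class of all
  compact convex sets and to the set of solutions.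
\<close>

lemma lower_semicontinuous_kc_attains_minimum:
  fixes F :: "'a::euclidean_space set \<Rightarrow> real"
  assumes F: "lower_semicontinuous_kc F" and S: "S \<subseteq> kc_sets" "S \<noteq> {}"
    and nonneg: "\<And>X. X \<in> S \<Longrightarrow> 0 \<le> F X"
    and subseq: "\<And>X c. (\<And>n. X n \<in> S) \<Longrightarrow> (\<And>n. F (X n) \<le> c) \<Longrightarrow>
      \<exists>Y\<in>S. \<exists>r::nat \<Rightarrow> nat. strict_mono r \<and> (\<lambda>n. hausdorff_dist (X (r n)) Y) \<longlonglongrightarrow> 0"
  obtains Y where "Y \<in> S" "\<And>Z. Z \<in> S \<Longrightarrow> F Y \<le> F Z"
proof -
  let ?m = "INF X\<in>S. F X"
  have bdd: "bdd_below (F ` S)"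
    by (rule bdd_belowI2[of S 0 F]) (rule nonneg)
  have "\<exists>X\<in>S. F X < ?m + inverse (real (Suc n))" for n
    using cInf_lessD[of "F ` S" "?m + inverse (real (Suc n))"] S(2) by auto
  then obtain X where X: "\<And>n. X n \<in> S" "\<And>n. F (X n) < ?m + inverse (real (Suc n))"
    by metis
  have "F (X n) \<le> ?m + 1" for n
  proof -
    have "inverse (real (Suc n)) \<le> 1" by (simp add: field_simps)
    with X(2)[of n] show ?thesis by linarith
  qed
  then obtain Y r where Y: "Y \<in> S" and r: "strict_mono (r :: nat \<Rightarrow> nat)"
    and lim: "(\<lambda>n. hausdorff_dist (X (r n)) Y) \<longlonglongrightarrow> 0"
    using subseq[of X "?m + 1"] X(1) by blast
  have "(\<lambda>n. ?m + inverse (real (Suc n))) \<longlonglongrightarrow> ?m + 0"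
    by (intro tendsto_intros LIMSEQ_inverse_real_of_nat)
  then have u: "(\<lambda>n. ?m + inverse (real (Suc (r n)))) \<longlonglongrightarrow> ?m"
    using LIMSEQ_subseq_LIMSEQ[OF _ r] by (fastforce simp: o_def)
  have "F Y \<le> ?m"
  proof (rule lower_semicontinuous_kc_le_limit[OF F _ _ lim _ u])
    show "F (X (r n)) \<le> ?m + inverse (real (Suc (r n)))" for n
      using X(2) by (simp add: less_imp_le)
  qed (use X Y S in auto)
  then have "F Y \<le> F Z" if "Z \<in> S" for Z
    using cINF_lower[OF bdd that] by linarith
  with Y show thesis by (rule that)
qed

lemma lower_semicontinuous_kc_regularized:
  assumes A: "A \<in> kc_sets" and B: "B \<in> kc_sets" and R: "lower_semicontinuous_kc R" and g: "0 \<le> g"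
  shows "lower_semicontinuous_kc (\<lambda>X. hausdorff_dist A (B + X) + g * R X)"
  unfolding lower_semicontinuous_kc_def
proof (intro ballI allI impI)
  fix X :: "'a set" and e :: real
  assume X: "X \<in> kc_sets" and e: "0 < e"
  (* Half of e is spent on each summand; the + 1 covers g = 0. *)
  let ?e = "e / (2 * (g + 1))"
  have "0 < ?e" using e g by simp
  then obtain d where d: "0 < d" "\<And>Y. Y \<in> kc_sets \<Longrightarrow> hausdorff_dist Y X < d \<Longrightarrow> R X - ?e < R Y"
    using R X unfolding lower_semicontinuous_kc_def by meson
  show "\<exists>d>0. \<forall>Y\<in>kc_sets. hausdorff_dist Y X < d \<longrightarrow>
      hausdorff_dist A (B + X) + g * R X - e < hausdorff_dist A (B + Y) + g * R Y"
  proof (intro exI[of _ "min d (e / 2)"] conjI ballI impI)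
    fix Y :: "'a set"
    assume Y: "Y \<in> kc_sets" and YX: "hausdorff_dist Y X < min d (e / 2)"
    have "hausdorff_dist A (B + X) - e / 2 < hausdorff_dist A (B + Y)"
      using hausdorff_dist_sum_Lipschitz[OF A B X Y] YX by simp
    moreover have "g * (R X - ?e) \<le> g * R Y"
      using d(2)[OF Y] YX g by (intro mult_left_mono) auto
    moreover have "g * ?e \<le> e / 2"
      using e g by (simp add: field_simps)
    ultimately show "hausdorff_dist A (B + X) + g * R X - e < hausdorff_dist A (B + Y) + g * R Y"
      by (simp add: right_diff_distrib)
  qed (use d e in simp)
qed

lemma regularized_problem_has_minimizer:
  fixes A B :: "'a::euclidean_space set"
  assumes A: "A \<in> kc_sets" and B: "B \<in> kc_sets" and R: "lower_semicontinuous_kc R"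
    and nonneg: "R \<in> kc_sets \<rightarrow> {0..}" and g: "0 \<le> g"
  shows "\<exists>Y\<in>kc_sets. \<forall>Z\<in>kc_sets.
    hausdorff_dist A (B + Y) + g * R Y \<le> hausdorff_dist A (B + Z) + g * R Z"
proof (rule lower_semicontinuous_kc_attains_minimum)
  show "lower_semicontinuous_kc (\<lambda>X. hausdorff_dist A (B + X) + g * R X)"
    by (rule lower_semicontinuous_kc_regularized[OF A B R g])
  have gR: "0 \<le> g * R X" if "X \<in> kc_sets" for X
    using nonneg g that by (auto intro: mult_nonneg_nonneg)
  show "0 \<le> hausdorff_dist A (B + X) + g * R X" if "X \<in> kc_sets" for X
    using gR[OF that] hausdorff_dist_nonneg[OF A kc_sets_plus[OF B that]] by simp
  show "kc_sets \<noteq> ({} :: 'a set set)"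
    using singleton_kc by blast
  fix X :: "nat \<Rightarrow> 'a set" and c
  assume X: "\<And>n. X n \<in> kc_sets" "\<And>n. hausdorff_dist A (B + X n) + g * R (X n) \<le> c"
  have bound: "hausdorff_dist A (B + X n) \<le> c" for n
    using X(2)[of n] gR[OF X(1), of n] by linarith
  show "\<exists>Y\<in>kc_sets. \<exists>r::nat \<Rightarrow> nat. strict_mono r \<and> (\<lambda>n. hausdorff_dist (X (r n)) Y) \<longlonglongrightarrow> 0"
    by (rule hausdorff_dist_sum_bounded_imp_convergent_subseq[OF A B X(1) bound])
qed auto

lemma regularized_solution_minimizes:
  assumes "A \<in> kc_sets" "B \<in> kc_sets" "lower_semicontinuous_kc R" "R \<in> kc_sets \<rightarrow> {0..}" "0 \<le> g"
  shows "regularized_solution A B R g \<in> kc_sets"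
    and "Z \<in> kc_sets \<Longrightarrow> hausdorff_dist A (B + regularized_solution A B R g)
      + g * R (regularized_solution A B R g) \<le> hausdorff_dist A (B + Z) + g * R Z"
proof -
  let ?F = "\<lambda>X. hausdorff_dist A (B + X) + g * R X"
  obtain Y where "is_arg_min ?F (\<lambda>X. X \<in> kc_sets) Y"
    using regularized_problem_has_minimizer[OF assms(1,2,3,4,5)] by (auto simp: is_arg_min_linorder)
  then have "is_arg_min ?F (\<lambda>X. X \<in> kc_sets) (regularized_solution A B R g)"
    unfolding regularized_solution_def arg_min_on_def arg_min_def by (rule someI)
  then show "regularized_solution A B R g \<in> kc_sets"
    and "Z \<in> kc_sets \<Longrightarrow> ?F (regularized_solution A B R g) \<le> ?F Z"
    by (auto simp: is_arg_min_linorder)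
qed

section \<open>The solution set\<close>

text \<open>
  Distances are nonnegative, so the infimum in the definition is a genuine greatest lower bound and
  can be traded for a comparison with each competitor.
\<close>

lemma minkowski_solutions_iff:
  assumes "A \<in> kc_sets" "B \<in> kc_sets"
  shows "X \<in> minkowski_solutions A B \<longleftrightarrow>
    X \<in> kc_sets \<and> (\<forall>Y\<in>kc_sets. hausdorff_dist A (B + X) \<le> hausdorff_dist A (B + Y))"
proof -
  have bdd: "bdd_below ((\<lambda>Y. hausdorff_dist A (B + Y)) ` kc_sets)"
    using assms by (intro bdd_belowI[of _ 0]) (auto intro: hausdorff_dist_nonneg kc_sets_plus)
  show ?thesis
    unfolding minkowski_solutions_def
    using cINF_lower[OF bdd] singleton_kc[of 0]
    by (auto intro!: antisym cINF_greatest)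
qed

text \<open>
  Two distinct minimizers of \<open>R\<close> among the solutions would have a midpoint that is again a solution,
  because \<open>hausdorff_dist A (B + X)\<close> is convex in \<open>X\<close>, and on which \<open>R\<close> is strictly smaller.
\<close>

lemma minkowski_solutions_unique_R_minimizer:
  fixes A B :: "'a::euclidean_space set"
  assumes A: "A \<in> kc_sets" and B: "B \<in> kc_sets" and R: "lower_semicontinuous_kc R"
    and nonneg: "R \<in> kc_sets \<rightarrow> {0..}" and strict: "strictly_convex_kc R"
  obtains X0 where "X0 \<in> minkowski_solutions A B"
    "\<And>Y. Y \<in> minkowski_solutions A B \<Longrightarrow> R Y \<le> R X0 \<Longrightarrow> Y = X0"
proof -
  let ?M = "minkowski_solutions A B" and ?f = "\<lambda>X. hausdorff_dist A (B + X)"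
  note M_iff = minkowski_solutions_iff[OF A B]
  have f_lsc: "lower_semicontinuous_kc ?f"
    using lower_semicontinuous_kc_regularized[OF A B R, of 0] by simp
  obtain X1 where X1: "X1 \<in> ?M"
    using regularized_problem_has_minimizer[OF A B R nonneg, of 0] by (auto simp: M_iff)
  obtain X0 where X0: "X0 \<in> ?M" "\<And>Z. Z \<in> ?M \<Longrightarrow> R X0 \<le> R Z"
  proof (rule lower_semicontinuous_kc_attains_minimum[OF R])
    fix X :: "nat \<Rightarrow> 'a set"
    assume X: "\<And>n. X n \<in> ?M"
    then have kc: "\<And>n. X n \<in> kc_sets" and min: "\<And>n Z. Z \<in> kc_sets \<Longrightarrow> ?f (X n) \<le> ?f Z"
      by (auto simp: M_iff)
    obtain Y r where Y: "Y \<in> kc_sets" and r: "strict_mono (r :: nat \<Rightarrow> nat)"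
      and lim: "(\<lambda>n. hausdorff_dist (X (r n)) Y) \<longlonglongrightarrow> 0"
      using hausdorff_dist_sum_bounded_imp_convergent_subseq[of A B X, OF A B kc min[OF kc]] by blast
    have "?f Y \<le> ?f Z" if "Z \<in> kc_sets" for Z
      by (rule lower_semicontinuous_kc_le_limit[OF f_lsc Y kc lim min[OF that] tendsto_const])
    then show "\<exists>Y\<in>?M. \<exists>r::nat \<Rightarrow> nat. strict_mono r \<and> (\<lambda>n. hausdorff_dist (X (r n)) Y) \<longlonglongrightarrow> 0"
      using Y r lim by (auto simp: M_iff)
  next
    show "?M \<noteq> {}" using X1 by blast
  qed (use nonneg in \<open>auto simp: M_iff\<close>)
  have "Y = X0" if Y: "Y \<in> ?M" "R Y \<le> R X0" for Y
  proof (rule ccontr)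
    assume "Y \<noteq> X0"
    let ?Z = "(*\<^sub>R) (1/2) ` Y + (*\<^sub>R) (1 - 1/2) ` X0"
    have kc: "Y \<in> kc_sets" "X0 \<in> kc_sets" and min: "\<And>W. W \<in> kc_sets \<Longrightarrow> ?f Y \<le> ?f W"
        "\<And>W. W \<in> kc_sets \<Longrightarrow> ?f X0 \<le> ?f W"
      using Y X0(1) by (auto simp: M_iff)
    have "?f ?Z \<le> 1/2 * ?f Y + (1 - 1/2) * ?f X0"
      by (rule hausdorff_dist_sum_convex[OF A B kc]) auto
    also have "1/2 * ?f Y + (1 - 1/2) * ?f X0 \<le> ?f W" if "W \<in> kc_sets" for W
      using min[OF that] by simp
    finally have "?f ?Z \<le> ?f W" if "W \<in> kc_sets" for W
      using that .
    then have "?Z \<in> ?M"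
      using kc_sets_convex_combination[OF kc] by (simp only: M_iff) blast
    then have "R X0 \<le> R ?Z"
      by (rule X0(2))
    moreover have "R ?Z < (R Y + R X0) / 2"
      using strict[unfolded strictly_convex_kc_def, rule_format, OF kc \<open>Y \<noteq> X0\<close>, of "1/2"]
      by simp
    ultimately show False
      using Y(2) by simp
  qed
  with X0(1) show thesis by (rule that)
qed

section \<open>Convergence as the penalty vanishes\<close>

theorem proposition10:
  fixes A B :: "(real ^ 'd) set"
    and R :: "(real ^ 'd) set \<Rightarrow> real"
  assumes "A \<in> kc_sets" and "B \<in> kc_sets"
    and "R \<in> kc_sets \<rightarrow> {0..}"
    and "strictly_convex_kc R"
    and "lower_semicontinuous_kc R"
  shows "\<exists>X0 \<in> minkowski_solutions A B.
    ((\<lambda>g. hausdorff_dist (regularized_solution A B R g) X0) \<longlongrightarrow> 0) (at_right 0)"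
proof -
  let ?f = "\<lambda>X. hausdorff_dist A (B + X)" and ?X = "regularized_solution A B R"
  note min = regularized_solution_minimizes[OF assms(1,2,5,3)]
  have f_lsc: "lower_semicontinuous_kc ?f"
    using lower_semicontinuous_kc_regularized[OF assms(1,2,5), of 0] by simp
  obtain X0 where X0: "X0 \<in> minkowski_solutions A B"
    and unique: "\<And>Y. Y \<in> minkowski_solutions A B \<Longrightarrow> R Y \<le> R X0 \<Longrightarrow> Y = X0"
    using minkowski_solutions_unique_R_minimizer[OF assms(1,2,5,3,4)] by blast
  have X0_kc: "X0 \<in> kc_sets" and X0_min: "\<And>Y. Y \<in> kc_sets \<Longrightarrow> ?f X0 \<le> ?f Y"
    using X0 by (auto simp: minkowski_solutions_iff[OF assms(1,2)])
  have R_nonneg: "0 \<le> R X" if "X \<in> kc_sets" for X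
    using assms(3) that by auto
  have R_le: "R (?X g) \<le> R X0" if g: "0 < g" for g
  proof -
    have "g * R (?X g) \<le> g * R X0"
      using min(2)[of g X0] X0_min[OF min(1)[of g]] X0_kc g by linarith
    with g show ?thesis by simp
  qed
  have f_le: "?f (?X g) \<le> ?f X0 + g * R X0" if g: "0 < g" for g
  proof -
    have "0 \<le> g * R (?X g)"
      using g R_nonneg[OF min(1)[of g]] by simp
    then show ?thesis
      using min(2)[of g X0] X0_kc g by linarith
  qed
  have "\<forall>\<^sub>F g in at_right 0. hausdorff_dist (?X g) X0 < e" if e: "0 < e" for e
  proof (rule ccontr)
    assume "\<not> ?thesis"
    then have "\<exists>g>0. g < inverse (real (Suc n)) \<and> e \<le> hausdorff_dist (?X g) X0" for n
      unfolding eventually_at_right_field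
      by (metis not_le inverse_positive_iff_positive of_nat_0_less_iff zero_less_Suc)
    then obtain g where g: "\<And>n. 0 < g n" "\<And>n. g n < inverse (real (Suc n))"
      and far: "\<And>n. e \<le> hausdorff_dist (?X (g n)) X0"
      by metis
    have g_lim: "g \<longlonglongrightarrow> 0"
      by (rule tendsto_sandwich[OF _ _ tendsto_const LIMSEQ_inverse_real_of_nat])
        (use g in \<open>auto intro: less_imp_le always_eventually\<close>)
    have kc: "?X (g n) \<in> kc_sets" for n
      using min(1) g(1) by (simp add: less_imp_le)
    have bound: "?f (?X (g n)) \<le> ?f X0 + R X0" for n
    proof -
      have "inverse (real (Suc n)) \<le> 1" by (simp add: field_simps)
      then have "g n * R X0 \<le> 1 * R X0"
        using g(2)[of n] R_nonneg[OF X0_kc] by (intro mult_right_mono) linarith+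
      then show ?thesis
        using f_le[OF g(1), of n] by linarith
    qed
    obtain Y r where Y: "Y \<in> kc_sets" and r: "strict_mono (r :: nat \<Rightarrow> nat)"
      and lim: "(\<lambda>n. hausdorff_dist (?X (g (r n))) Y) \<longlonglongrightarrow> 0"
      using hausdorff_dist_sum_bounded_imp_convergent_subseq[of A B "\<lambda>n. ?X (g n)", OF assms(1,2) kc bound]
      by blast
    have "(\<lambda>n. ?f X0 + g (r n) * R X0) \<longlonglongrightarrow> ?f X0 + 0 * R X0"
      using LIMSEQ_subseq_LIMSEQ[OF g_lim r] by (intro tendsto_intros) (simp add: o_def)
    then have "?f Y \<le> ?f X0"
      using lower_semicontinuous_kc_le_limit[OF f_lsc Y kc lim f_le[OF g(1)]] by simp
    then have "Y \<in> minkowski_solutions A B"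
      using Y X0_min by (auto intro: order_trans simp: minkowski_solutions_iff[OF assms(1,2)])
    moreover have "R Y \<le> R X0"
      by (rule lower_semicontinuous_kc_le_limit[OF assms(5) Y kc lim R_le[OF g(1)] tendsto_const])
    ultimately have "Y = X0"
      by (rule unique)
    then have "e \<le> 0"
      using tendsto_lowerbound[OF lim] far by auto
    with e show False by simp
  qed
  moreover have "\<forall>\<^sub>F g in at_right 0. 0 \<le> hausdorff_dist (?X g) X0"
    using eventually_at_right_less[of "0::real"]
    by eventually_elim (use min(1) X0_kc in \<open>simp add: hausdorff_dist_nonneg\<close>)
  ultimately have "((\<lambda>g. hausdorff_dist (?X g) X0) \<longlongrightarrow> 0) (at_right 0)"
    by (intro order_tendstoI) (auto elim: eventually_mono)
  with X0 show ?thesis by blast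
qed

end
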